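(* Suppose retractions are verifying. Let $\hat P$ denote the beliefs of any quasi-Bayesian decision-maker. Let $t\ge 1$, let $S_t=\{s_1,\dots,s_t\}$ be any realised sequence of draws, and let $\rho\in\{1,\dots,t\}$ be such that the $\rho$-th observation is retracted in period $t+1$ (an event of positive probability given $S_t$). Then: (a) the belief after observing the retraction $n_\rho=N$ in period $t+1$ is the same as the belief had the retracted observation $s_\rho$ never been observed, i.e. $\hat P(\theta\mid S_t,\,n_\rho=N)=\hat P(\theta\mid S_t\setminus s_\rho)$; (b) for any draw $s_{t+1}\in\{\text{yellow},\text{blue}\}$, the belief after observing the retraction $n_\rho=N$ in period $t+1$ is the same as the belief following the new draw $s_{t+1}$ in period $t+1$ instead of the retraction, i.e. $\hat P(\theta\mid S_t,\,n_\rho=N)=\hat P(\theta\mid S_t\cup s_{t+1})$, if and only if $K(s_{t+1})=-K(s_\rho)$.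
   Context: **State and draws.** The state $\theta\in\{\text{yellow},\text{blue}\}$ takes each value with probability $1/2$. For each period $j$ there are a truth/noise indicator $n_j\in\{T,N\}$ and a noise realisation $\epsilon_j\in\{\text{yellow},\text{blue}\}$; the variables $\theta,(n_j)_j,(\epsilon_j)_j$ are mutually independent. The draw (observation) in period $j$ is $s_j=\theta$ if $n_j=T$ and $s_j=\epsilon_j$ if $n_j=N$; hence draws are independent across periods conditional on $\theta$. It is assumed that $P(n_j=N)\in(0,1)$ and $P(\epsilon_j=\text{yellow})\in(0,1)$, so all likelihoods below are positive and all log-likelihood ratios are finite. $P$ denotes objective probabilities. Draws reveal $s_j$ but not $n_j$. **Retractions.** After the draws $S_t=\{s_1,\dots,s_t\}$ (with their order), in period $t+1$ the decision-maker sees either a new draw $s_{t+1}$ or a verification. In a verification, an index $R\in\{1,\dots,t\}$ is selected, and the selected index and the value $n_R$ are revealed. A retraction of the $\rho$-th observation is the event $\{R=\rho,\ n_\rho=N\}$, written briefly $n_\rho=N$. Retractions are verifying if the selected index is chosen independently of the truth value of that and of all other observations: conditional on the observed draws $S_t$, $R$ is independent of $(\theta,n_1,\dots,n_t)$ (for example, $R$ uniform on $\{1,\dots,t\}$ and independent of everything else). **Notation.** $\mathcal L(p)=\ln\frac{p}{1-p}$ for $p\in(0,1)$. For a draw, $K(s_j)=\ln\frac{P(s_j\mid\theta=\text{yellow})}{P(s_j\mid\theta=\text{blue})}$, where $P(s_j\mid\theta)$ is the probability that the period-$j$ draw has the realised colour. More generally, for a piece of information $E$ (a new draw or a retraction)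 arriving after history $\mathcal H$, $K(E)=\ln\frac{P(E\mid\mathcal H,\theta=\text{yellow})}{P(E\mid\mathcal H,\theta=\text{blue})}$; for draws this coincides with $K(s_j)$. **Beliefs.** For a history $\mathcal H$ (an ordered collection of observed draws and possibly a retraction), $\hat P(\theta\mid\mathcal H)$ denotes the decision-maker's subjective probability that $\theta=\text{yellow}$ given $\mathcal H$. The history $S_t\setminus s_\rho$ consists of the draws $s_j$, $j\in\{1,\dots,t\}$, $j\neq\rho$, in order (the period-$\rho$ draw was never observed); $S_t\cup s_{t+1}$ consists of $s_1,\dots,s_{t+1}$. **Quasi-Bayesian.** A decision-maker is quasi-Bayesian if there is a strictly increasing function $f:(0,1)\to(0,1)$ such that all of their beliefs (including the initial belief at the empty history, which is the same before any sequence of information) lie in the range of $f$, and for every history $\mathcal H$ and every piece of information $E$ arriving after $\mathcal H$ with positive probability, the belief $\hat p'=\hat P(\theta\mid\mathcal H,E)$ is obtained from $\hat p=\hat P(\theta\mid\mathcal H)$ by $$\mathcal L\big(f^{-1}(\hat p')\big)=\mathcal L\big(f^{-1}(\hat p)\big)+K(E).$$ The function $f$ is the same for all histories and all $E$. *)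

theory Defs
  imports "HOL-Probability.Probability"
begin

datatype color = Yellow | Blue

datatype indicator = Truth | Noise

datatype source = State | Indicator nat | Noise_draw nat

text \<open>
  \<open>Draw j c\<close>: the draw of period \<open>j\<close> is observed and has colour \<open>c\<close>.
  \<open>Retraction p r\<close>: in period \<open>p\<close> a verification takes place; it selects observation \<open>r\<close> and
  reveals that this observation was noise.
  A history lists its pieces of information in the order of observation. Periods are recorded
  because the law of the draws may differ between periods.
\<close>

datatype info = Draw nat color | Retraction nat nat

fun period :: "info \<Rightarrow> nat" where
  "period (Draw j c) = j"
| "period (Retraction p r) = p"

definition draws :: "(nat \<Rightarrow> color) \<Rightarrow> nat \<Rightarrow> info list" where
  "draws s t = map (\<lambda>j. Draw j (s j)) [1..<Suc t]"

definition draws_omitting :: "(nat \<Rightarrow> color) \<Rightarrow> nat \<Rightarrow> nat \<Rightarrow> info list" where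
  "draws_omitting s t r = map (\<lambda>j. Draw j (s j)) (filter (\<lambda>j. j \<noteq> r) [1..<Suc t])"

text \<open>
  Draws come in increasing order of periods, and a period may pass without its draw being observed.
  A verification in period \<open>t + 1\<close> takes place after all of the draws of periods
  \<open>1, \<dots>, t\<close>; a history contains at most one retraction.
\<close>

inductive history :: "info list \<Rightarrow> bool" where
  empty: "history []"
| draw: "history h \<Longrightarrow> 1 \<le> j \<Longrightarrow> (\<forall>e\<in>set h. period e < j) \<Longrightarrow> history (h @ [Draw j c])"
| retraction: "r \<in> {1..t} \<Longrightarrow> history (draws s t @ [Retraction (t + 1) r])"

definition logit :: "real \<Rightarrow> real" where
  "logit p = ln (p / (1 - p))"

text \<open>
  \<open>selected p\<close> is the index that a verification in period \<open>p\<close> selects. Whether period \<open>p\<close> shows a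
  draw or a verification is not random: both are described on the same probability space and
  enter different histories.
  The random variables \<open>theta\<close> and \<open>eps j\<close> are embedded by \<open>Inl\<close>, and \<open>ind j\<close> by \<open>Inr\<close>, only
  because \<open>indep_vars\<close> needs a common value type.
\<close>

locale retraction_model = prob_space M for M :: "'a measure" +
  fixes theta :: "'a \<Rightarrow> color"
    and ind :: "nat \<Rightarrow> 'a \<Rightarrow> indicator"
    and eps :: "nat \<Rightarrow> 'a \<Rightarrow> color"
    and selected :: "nat \<Rightarrow> 'a \<Rightarrow> nat"
  assumes independent:
      "indep_vars (\<lambda>_. count_space UNIV)
         (\<lambda>i \<omega>. case i of State \<Rightarrow> Inl (theta \<omega>)
                        | Indicator j \<Rightarrow> Inr (ind j \<omega>)
                        | Noise_draw j \<Rightarrow> Inl (eps j \<omega>))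
         ({State} \<union> Indicator ` {1..} \<union> Noise_draw ` {1..})"
    and prior: "\<P>(\<omega> in M. theta \<omega> = Yellow) = 1 / 2" "\<P>(\<omega> in M. theta \<omega> = Blue) = 1 / 2"
    and noise_prob: "\<And>j. 1 \<le> j \<Longrightarrow> \<P>(\<omega> in M. ind j \<omega> = Noise) \<in> {0<..<1}"
    and eps_prob: "\<And>j. 1 \<le> j \<Longrightarrow> \<P>(\<omega> in M. eps j \<omega> = Yellow) \<in> {0<..<1}"
    and selected_measurable: "\<And>t. 1 \<le> t \<Longrightarrow> selected (t + 1) \<in> M \<rightarrow>\<^sub>M count_space UNIV"
    and selected_range: "\<And>t \<omega>. 1 \<le> t \<Longrightarrow> \<omega> \<in> space M \<Longrightarrow> selected (t + 1) \<omega> \<in> {1..t}"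
begin

definition obs :: "nat \<Rightarrow> 'a \<Rightarrow> color" where
  "obs j \<omega> = (if ind j \<omega> = Truth then theta \<omega> else eps j \<omega>)"

fun occurs :: "info \<Rightarrow> 'a \<Rightarrow> bool" where
  "occurs (Draw j c) \<omega> \<longleftrightarrow> obs j \<omega> = c"
| "occurs (Retraction p r) \<omega> \<longleftrightarrow> selected p \<omega> = r \<and> ind r \<omega> = Noise"

definition occurs_all :: "info list \<Rightarrow> 'a \<Rightarrow> bool" where
  "occurs_all h \<omega> \<longleftrightarrow> (\<forall>e\<in>set h. occurs e \<omega>)"

text \<open>
  Conditional on the observed draws, \<open>selected (t + 1)\<close> is independent of the random vector
  \<open>(theta, ind 1, \<dots>, ind t)\<close>; all of these take finitely many values.
\<close>

definition verifying :: bool where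
  "verifying \<longleftrightarrow> (\<forall>t\<ge>1. \<forall>s r x n.
     \<P>(\<omega> in M. selected (t + 1) \<omega> = r \<and> (theta \<omega> = x \<and> (\<forall>j\<in>{1..t}. ind j \<omega> = n j))
        \<bar> occurs_all (draws s t) \<omega>)
     = \<P>(\<omega> in M. selected (t + 1) \<omega> = r \<bar> occurs_all (draws s t) \<omega>)
       * \<P>(\<omega> in M. theta \<omega> = x \<and> (\<forall>j\<in>{1..t}. ind j \<omega> = n j) \<bar> occurs_all (draws s t) \<omega>))"

definition K_draw :: "nat \<Rightarrow> color \<Rightarrow> real" where
  "K_draw j c = ln (\<P>(\<omega> in M. obs j \<omega> = c \<bar> theta \<omega> = Yellow)
                    / \<P>(\<omega> in M. obs j \<omega> = c \<bar> theta \<omega> = Blue))"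

definition K_info :: "info list \<Rightarrow> info \<Rightarrow> real" where
  "K_info h e = ln (\<P>(\<omega> in M. occurs e \<omega> \<bar> occurs_all h \<omega> \<and> theta \<omega> = Yellow)
                    / \<P>(\<omega> in M. occurs e \<omega> \<bar> occurs_all h \<omega> \<and> theta \<omega> = Blue))"

text \<open>
  \<open>B h\<close> is the subjective probability of the state being yellow after the history \<open>h\<close>; its values
  at lists that are not histories or have probability zero are left unconstrained.
\<close>

definition quasi_bayesian :: "(info list \<Rightarrow> real) \<Rightarrow> bool" where
  "quasi_bayesian B \<longleftrightarrow> (\<exists>f :: real \<Rightarrow> real.
     f \<in> {0<..<1} \<rightarrow> {0<..<1} \<and> strict_mono_on {0<..<1} f \<and>
     (\<forall>h. history h \<and> \<P>(\<omega> in M. occurs_all h \<omega>) > 0 \<longrightarrow> B h \<in> f ` {0<..<1}) \<and>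
     (\<forall>h e. history h \<and> history (h @ [e]) \<and> \<P>(\<omega> in M. occurs e \<omega> \<bar> occurs_all h \<omega>) > 0 \<longrightarrow>
        logit (the_inv_into {0<..<1} f (B (h @ [e])))
          = logit (the_inv_into {0<..<1} f (B h)) + K_info h e))"

end

end

theory Submission imports Defs begin

text \<open>
  On the logit scale of \<open>f\<inverse>\<close> applied to the belief, every draw adds its \<open>K\<close>, in any order, and a
  verifying retraction of observation \<open>r\<close> adds \<open>- K (s r)\<close>. So the retraction deletes the summand
  of \<open>s r\<close>, and beliefs agree exactly when these sums agree, since \<open>f\<close> is injective.
\<close>

section \<open>Finite value types, log-odds and histories of draws\<close>

instance color :: finite
proof
  have "(UNIV :: color set) = {Yellow, Blue}"
    using color.exhaust by blast
  then show "finite (UNIV :: color set)"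
    by (metis finite.emptyI finite.insertI)
qed

text \<open>Both value types being finite makes every set of pairs \<open>A j\<close> in
  \<open>joint_prob\<close> finite and leaves finitely many indicator vectors to sum over in
  \<open>prob_split_indicators\<close>.\<close>

instance indicator :: finite
proof
  have "(UNIV :: indicator set) = {Truth, Noise}"
    using indicator.exhaust by blast
  then show "finite (UNIV :: indicator set)"
    by (metis finite.emptyI finite.insertI)
qed

text \<open>Odds are positive on the open unit interval, so \<open>ln\<close> cancels, and odds
  determine the probability.\<close>

lemma logit_inj_on: "inj_on logit {0<..<1}"
proof (rule inj_onI)
  fix p q :: real
  assume pq: "p \<in> {0<..<1}" "q \<in> {0<..<1}" and "logit p = logit q"
  then have "p / (1 - p) = q / (1 - q)"
    by (simp add: logit_def)
  with pq show "p = q"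
    by (simp add: field_simps)
qed

text \<open>Gaps between periods are allowed, so this serves both \<open>draws\<close> and
  \<open>draws_omitting\<close>.\<close>

lemma history_draws_sorted:
  assumes "sorted_wrt (<) js" and "set js \<subseteq> {1..}"
  shows "history (map (\<lambda>j. Draw j (s j)) js)"
  using assms
proof (induction js rule: rev_induct)
  case Nil
  then show ?case by (simp add: history.empty)
next
  case (snoc j js)
  then show ?case
    using history.draw[of "map (\<lambda>j. Draw j (s j)) js" j "s j"]
    by (auto simp: sorted_wrt_append)
qed

context retraction_model
begin

section \<open>Measurability of state, indicators, noise and draws\<close>

text \<open>Measurability is part of \<open>indep_vars\<close>; \<open>projl\<close> undoes the
  embedding into the sum type.\<close>

lemma theta_measurable [measurable]: "theta \<in> M \<rightarrow>\<^sub>M count_space UNIV"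
proof -
  have "(\<lambda>\<omega>. Inl (theta \<omega>) :: color + indicator) \<in> M \<rightarrow>\<^sub>M count_space UNIV"
    using independent unfolding indep_vars_def by (auto dest!: bspec[where x = State])
  then have "projl \<circ> (\<lambda>\<omega>. Inl (theta \<omega>) :: color + indicator) \<in> M \<rightarrow>\<^sub>M count_space UNIV"
    by (rule measurable_comp) simp
  then show ?thesis by (simp add: comp_def)
qed

lemma ind_measurable:
  assumes "1 \<le> j" shows "ind j \<in> M \<rightarrow>\<^sub>M count_space UNIV"
proof -
  have "(\<lambda>\<omega>. Inr (ind j \<omega>) :: color + indicator) \<in> M \<rightarrow>\<^sub>M count_space UNIV"
    using independent assms unfolding indep_vars_def by (auto dest!: bspec[where x = "Indicator j"])
  then have "projr \<circ> (\<lambda>\<omega>. Inr (ind j \<omega>) :: color + indicator) \<in> M \<rightarrow>\<^sub>M count_space UNIV"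
    by (rule measurable_comp) simp
  then show ?thesis by (simp add: comp_def)
qed

lemma eps_measurable:
  assumes "1 \<le> j" shows "eps j \<in> M \<rightarrow>\<^sub>M count_space UNIV"
proof -
  have "(\<lambda>\<omega>. Inl (eps j \<omega>) :: color + indicator) \<in> M \<rightarrow>\<^sub>M count_space UNIV"
    using independent assms unfolding indep_vars_def by (auto dest!: bspec[where x = "Noise_draw j"])
  then have "projl \<circ> (\<lambda>\<omega>. Inl (eps j \<omega>) :: color + indicator) \<in> M \<rightarrow>\<^sub>M count_space UNIV"
    by (rule measurable_comp) simp
  then show ?thesis by (simp add: comp_def)
qed

lemma obs_measurable:
  assumes "1 \<le> j" shows "obs j \<in> M \<rightarrow>\<^sub>M count_space UNIV"
proof -
  note [measurable] = ind_measurable[OF assms] eps_measurable[OF assms]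
  show ?thesis unfolding obs_def[abs_def] by measurable
qed

section \<open>Product formula for the state and the periods\<close>

text \<open>The joint law of indicator and noise colour in one period. Given the state, a draw is a
  function of this pair, so the pair can be treated as one unit.\<close>

definition pair_prob :: "nat \<Rightarrow> (indicator \<times> color) set \<Rightarrow> real" where
  "pair_prob j A = \<P>(\<omega> in M. (ind j \<omega>, eps j \<omega>) \<in> A)"

lemma prob_theta: "\<P>(\<omega> in M. theta \<omega> = x) = 1 / 2"
  using prior by (cases x) auto

text \<open>The block of period \<open>j \<ge> 1\<close> is \<open>{Indicator j, Noise_draw j}\<close>; the state is block \<open>0\<close>.\<close>

lemma joint_prob:
  assumes J: "finite J" "J \<subseteq> {1..}"
  shows "\<P>(\<omega> in M. theta \<omega> = x \<and> (\<forall>j\<in>J. (ind j \<omega>, eps j \<omega>) \<in> A j))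
           = 1 / 2 * (\<Prod>j\<in>J. pair_prob j (A j))"
proof -
  define X :: "source \<Rightarrow> 'a \<Rightarrow> color + indicator" where
    "X i \<omega> = (case i of State \<Rightarrow> Inl (theta \<omega>) | Indicator j \<Rightarrow> Inr (ind j \<omega>)
                        | Noise_draw j \<Rightarrow> Inl (eps j \<omega>))" for i \<omega>
  define block where "block i = (if i = 0 then {State} else {Indicator i, Noise_draw i})" for i :: nat
  define N where "N i = PiM (block i) (\<lambda>_. count_space (UNIV :: (color + indicator) set))" for i
  define Y where "Y i \<omega> = restrict (\<lambda>k. X k \<omega>) (block i)" for i \<omega>
  define S where "S i = (if i = 0 then {g \<in> space (N i). g State = Inl x}
      else {g \<in> space (N i). \<exists>p\<in>A i. g (Indicator i) = Inr (fst p) \<and> g (Noise_draw i) = Inl (snd p)})"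
    for i :: nat
  have "indep_vars (\<lambda>_. count_space UNIV) X ({State} \<union> Indicator ` {1..} \<union> Noise_draw ` {1..})"
    using independent unfolding X_def .
  \<comment> \<open>Functions of disjoint groups of independent variables are independent, here the
    restrictions to the blocks.\<close>
  then have "indep_vars N Y (insert 0 J)"
    unfolding N_def Y_def
    by (rule indep_vars_restrict) (use J in \<open>auto simp: block_def disjoint_family_on_def split: if_splits\<close>)
  moreover have "S i \<in> sets (N i)" for i
  proof (cases "i = 0")
    case True
    then have [measurable]: "(\<lambda>g. g State) \<in> N i \<rightarrow>\<^sub>M count_space UNIV"
      unfolding N_def by (intro measurable_component_singleton) (simp add: block_def)
    have "{g \<in> space (N i). g State = Inl x} \<in> sets (N i)" by measurable
    then show ?thesis using True by (simp add: S_def)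
  next
    case False
    then have [measurable]: "(\<lambda>g. g (Indicator i)) \<in> N i \<rightarrow>\<^sub>M count_space UNIV"
        "(\<lambda>g. g (Noise_draw i)) \<in> N i \<rightarrow>\<^sub>M count_space UNIV"
      unfolding N_def by (auto intro!: measurable_component_singleton simp: block_def)
    \<comment> \<open>Turns the existential over \<open>A i\<close> in \<open>S i\<close> into a
      finite union of measurable sets.\<close>
    have "finite (A i)" by simp
    then show ?thesis using False unfolding S_def by simp
  qed
  ultimately have indep: "prob (\<Inter>i\<in>insert 0 J. Y i -` S i \<inter> space M)
      = (\<Prod>i\<in>insert 0 J. prob (Y i -` S i \<inter> space M))"
    using J by (intro indep_varsD) auto
  have Y_space: "Y i \<omega> \<in> space (N i)" for i \<omega>
    by (simp add: Y_def N_def space_PiM)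
  have zero: "Y 0 -` S 0 \<inter> space M = {\<omega> \<in> space M. theta \<omega> = x}"
    using Y_space[of 0] by (auto simp: S_def Y_def block_def X_def)
  have pos: "Y j -` S j \<inter> space M = {\<omega> \<in> space M. (ind j \<omega>, eps j \<omega>) \<in> A j}" if "j \<in> J" for j
  proof -
    have "j \<noteq> 0" using that J by auto
    then show ?thesis using Y_space[of j]
      by (force simp: S_def Y_def block_def X_def)
  qed
  have "0 \<notin> J" using J by auto
  have "{\<omega> \<in> space M. theta \<omega> = x \<and> (\<forall>j\<in>J. (ind j \<omega>, eps j \<omega>) \<in> A j)}
      = (\<Inter>i\<in>insert 0 J. Y i -` S i \<inter> space M)"
    using zero pos by (auto; blast)
  then show ?thesis
    using indep J \<open>0 \<notin> J\<close> by (simp add: zero pos pair_prob_def prob_theta)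
qed

text \<open>Indicator and noise colour of one period are independent, and both factors are positive
  because neither variable is degenerate.\<close>

lemma pair_prob_noise_pos:
  assumes "1 \<le> j" shows "pair_prob j {(Noise, c)} > 0"
proof -
  note [measurable] = ind_measurable[OF assms] eps_measurable[OF assms]
  define X :: "source \<Rightarrow> 'a \<Rightarrow> color + indicator" where
    "X i \<omega> = (case i of State \<Rightarrow> Inl (theta \<omega>) | Indicator j \<Rightarrow> Inr (ind j \<omega>)
                        | Noise_draw j \<Rightarrow> Inl (eps j \<omega>))" for i \<omega>
  \<comment> \<open>Only the indices \<open>Indicator j\<close> and \<open>Noise_draw j\<close>
    enter the product, so the second branch concerns \<open>Noise_draw j\<close>.\<close>
  define S :: "source \<Rightarrow> (color + indicator) set" where
    "S i = (if i = Indicator j then {Inr Noise} else {Inl c})" for i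
  have "indep_vars (\<lambda>_. count_space UNIV) X ({State} \<union> Indicator ` {1..} \<union> Noise_draw ` {1..})"
    using independent unfolding X_def .
  then have "prob (\<Inter>i\<in>{Indicator j, Noise_draw j}. X i -` S i \<inter> space M)
      = (\<Prod>i\<in>{Indicator j, Noise_draw j}. prob (X i -` S i \<inter> space M))"
    by (rule indep_varsD) (use assms in auto)
  moreover have "(\<Inter>i\<in>{Indicator j, Noise_draw j}. X i -` S i \<inter> space M)
      = {\<omega> \<in> space M. (ind j \<omega>, eps j \<omega>) \<in> {(Noise, c)}}"
    "X (Indicator j) -` S (Indicator j) \<inter> space M = {\<omega> \<in> space M. ind j \<omega> = Noise}"
    "X (Noise_draw j) -` S (Noise_draw j) \<inter> space M = {\<omega> \<in> space M. eps j \<omega> = c}"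
    by (auto simp: X_def S_def)
  ultimately have "pair_prob j {(Noise, c)} = \<P>(\<omega> in M. ind j \<omega> = Noise) * \<P>(\<omega> in M. eps j \<omega> = c)"
    by (simp add: pair_prob_def)
  moreover have "\<P>(\<omega> in M. eps j \<omega> = c) > 0"
  proof (cases c)
    case Yellow
    then show ?thesis using eps_prob[OF assms] by simp
  next
    \<comment> \<open>Here the upper bound on the probability of \<open>Yellow\<close> is what
      matters.\<close>
    case Blue
    have "{\<omega> \<in> space M. eps j \<omega> = Blue} = space M - {\<omega> \<in> space M. eps j \<omega> = Yellow}"
      by (auto, metis color.exhaust)
    then have "\<P>(\<omega> in M. eps j \<omega> = Blue) = 1 - \<P>(\<omega> in M. eps j \<omega> = Yellow)"
      by (simp add: prob_compl)
    then show ?thesis using eps_prob[OF assms] Blue by simp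
  qed
  ultimately show ?thesis using noise_prob[OF assms] by simp
qed

text \<open>The conditional probability that draw \<open>j\<close> has colour \<open>c\<close> in state \<open>x\<close>; see \<open>cond_prob_obs\<close>.\<close>

definition likelihood :: "nat \<Rightarrow> color \<Rightarrow> color \<Rightarrow> real" where
  "likelihood j c x = pair_prob j {p. (if fst p = Truth then x else snd p) = c}"

text \<open>A noise draw of colour \<open>c\<close> shows \<open>c\<close> in either state, which
  bounds the likelihood from below.\<close>

lemma likelihood_pos:
  assumes "1 \<le> j" shows "likelihood j c x > 0"
proof -
  note [measurable] = ind_measurable[OF assms] eps_measurable[OF assms]
  have "pair_prob j {(Noise, c)} \<le> likelihood j c x"
    unfolding pair_prob_def likelihood_def by (intro finite_measure_mono) auto
  then show ?thesis using pair_prob_noise_pos[OF assms, of c] by linarith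
qed

section \<open>Probabilities of draws given the state\<close>

text \<open>Once \<open>theta\<close> is fixed to \<open>x\<close>, each draw is an event about the
  pair of its own period, so \<open>joint_prob\<close> applies.\<close>

lemma prob_theta_obs:
  assumes "finite J" "J \<subseteq> {1..}"
  shows "\<P>(\<omega> in M. theta \<omega> = x \<and> (\<forall>j\<in>J. obs j \<omega> = s j)) = 1 / 2 * (\<Prod>j\<in>J. likelihood j (s j) x)"
proof -
  have "{\<omega> \<in> space M. theta \<omega> = x \<and> (\<forall>j\<in>J. obs j \<omega> = s j)}
    = {\<omega> \<in> space M. theta \<omega> = x \<and>
        (\<forall>j\<in>J. (ind j \<omega>, eps j \<omega>) \<in> {p. (if fst p = Truth then x else snd p) = s j})}"
    by (auto simp: obs_def)
  then show ?thesis
    unfolding likelihood_def by (simp only: joint_prob[OF assms])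
qed

text \<open>Noise in period \<open>r\<close> forces the pair there to be
  \<open>(Noise, s r)\<close>. The resulting factor does not depend on the state \<open>x\<close>;
  this is why a retraction erases the information in draw \<open>r\<close>.\<close>

lemma prob_theta_obs_noise:
  assumes "finite J" "J \<subseteq> {1..}" "r \<in> J"
  shows "\<P>(\<omega> in M. theta \<omega> = x \<and> ind r \<omega> = Noise \<and> (\<forall>j\<in>J. obs j \<omega> = s j))
    = 1 / 2 * (pair_prob r {(Noise, s r)} * (\<Prod>j\<in>J - {r}. likelihood j (s j) x))"
proof -
  define A where "A j = (if j = r then {(Noise, s r)}
    else {p. (if fst p = Truth then x else snd p) = s j})" for j
  have "{\<omega> \<in> space M. theta \<omega> = x \<and> ind r \<omega> = Noise \<and> (\<forall>j\<in>J. obs j \<omega> = s j)}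
    = {\<omega> \<in> space M. theta \<omega> = x \<and> (\<forall>j\<in>J. (ind j \<omega>, eps j \<omega>) \<in> A j)}"
    using assms(3) by (fastforce simp: obs_def A_def split: if_splits)
  then have "\<P>(\<omega> in M. theta \<omega> = x \<and> ind r \<omega> = Noise \<and> (\<forall>j\<in>J. obs j \<omega> = s j))
    = 1 / 2 * (\<Prod>j\<in>J. pair_prob j (A j))"
    by (simp only: joint_prob[OF assms(1,2)])
  also have "(\<Prod>j\<in>J. pair_prob j (A j)) = pair_prob r (A r) * (\<Prod>j\<in>J - {r}. pair_prob j (A j))"
    using assms by (intro prod.remove)
  also have "(\<Prod>j\<in>J - {r}. pair_prob j (A j)) = (\<Prod>j\<in>J - {r}. likelihood j (s j) x)"
    by (intro prod.cong) (auto simp: A_def likelihood_def)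
  finally show ?thesis by (simp add: A_def)
qed

text \<open>Draws are independent given the state: in the quotient of the product formulas for
  \<open>insert j J\<close> and \<open>J\<close> only the factor of \<open>j\<close>
  survives.\<close>

lemma cond_prob_obs:
  assumes "finite J" "J \<subseteq> {1..}" "1 \<le> j" "j \<notin> J"
  shows "\<P>(\<omega> in M. obs j \<omega> = c \<bar> (\<forall>i\<in>J. obs i \<omega> = s i) \<and> theta \<omega> = x) = likelihood j c x"
proof -
  \<comment> \<open>Updating \<open>s\<close> at \<open>j\<close> makes the joint event an instance
    of \<open>prob_theta_obs\<close>; \<open>s\<close> is unchanged on \<open>J\<close> since
    \<open>j\<close> is not in \<open>J\<close>.\<close>
  have "{\<omega> \<in> space M. obs j \<omega> = c \<and> (\<forall>i\<in>J. obs i \<omega> = s i) \<and> theta \<omega> = x}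
    = {\<omega> \<in> space M. theta \<omega> = x \<and> (\<forall>i\<in>insert j J. obs i \<omega> = (s(j := c)) i)}"
    using assms by auto
  then have "\<P>(\<omega> in M. obs j \<omega> = c \<and> (\<forall>i\<in>J. obs i \<omega> = s i) \<and> theta \<omega> = x)
    = 1 / 2 * (\<Prod>i\<in>insert j J. likelihood i ((s(j := c)) i) x)"
    using assms prob_theta_obs[of "insert j J" x "s(j := c)"]
    by (simp only: finite_insert insert_subset) simp
  also have "\<dots> = likelihood j c x * (1 / 2 * (\<Prod>i\<in>J. likelihood i (s i) x))"
  proof -
    have "(\<Prod>i\<in>J. likelihood i ((s(j := c)) i) x) = (\<Prod>i\<in>J. likelihood i (s i) x)"
      using assms by (intro prod.cong) auto
    then show ?thesis using assms by simp
  qed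
  also have "1 / 2 * (\<Prod>i\<in>J. likelihood i (s i) x)
    = \<P>(\<omega> in M. (\<forall>i\<in>J. obs i \<omega> = s i) \<and> theta \<omega> = x)"
    using prob_theta_obs[OF assms(1,2), of x s] by (simp add: conj_commute)
  finally have eq: "\<P>(\<omega> in M. obs j \<omega> = c \<and> (\<forall>i\<in>J. obs i \<omega> = s i) \<and> theta \<omega> = x)
    = likelihood j c x * \<P>(\<omega> in M. (\<forall>i\<in>J. obs i \<omega> = s i) \<and> theta \<omega> = x)" .
  have "\<P>(\<omega> in M. (\<forall>i\<in>J. obs i \<omega> = s i) \<and> theta \<omega> = x) > 0"
    unfolding conj_commute[of "\<forall>i\<in>J. obs i _ = s i"] prob_theta_obs[OF assms(1,2)]
    using assms(2) by (auto intro!: prod_pos likelihood_pos)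
  then show ?thesis unfolding cond_prob_def eq by simp
qed

section \<open>Log-likelihood ratios of draws and beliefs after draws\<close>

lemma K_draw_likelihood:
  assumes "1 \<le> j"
  shows "K_draw j c = ln (likelihood j c Yellow / likelihood j c Blue)"
  using cond_prob_obs[of "{}" j c] assms by (simp add: K_draw_def)

lemma occurs_all_draws:
  "occurs_all (map (\<lambda>j. Draw j (s j)) js) \<omega> \<longleftrightarrow> (\<forall>j\<in>set js. obs j \<omega> = s j)"
  by (simp add: occurs_all_def)

text \<open>By conditional independence the earlier draws drop out of the likelihood ratio,
  whichever periods they come from.\<close>

lemma K_info_draw:
  assumes "set js \<subseteq> {1..}" "1 \<le> j" "j \<notin> set js"
  shows "K_info (map (\<lambda>j. Draw j (s j)) js) (Draw j c) = K_draw j c"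
  using assms by (simp add: K_info_def occurs_all_draws cond_prob_obs K_draw_likelihood)

lemma obs_event:
  assumes "finite J" "J \<subseteq> {1..}"
  shows "{\<omega> \<in> space M. \<forall>j\<in>J. obs j \<omega> = s j} \<in> events"
proof -
  have "Measurable.pred M (\<lambda>\<omega>. obs j \<omega> = s j)" if "j \<in> J" for j
  proof -
    have [measurable]: "obs j \<in> M \<rightarrow>\<^sub>M count_space UNIV"
      using that assms by (intro obs_measurable) auto
    show ?thesis by measurable
  qed
  then show ?thesis
    using assms by (intro predE pred_intros_finite) auto
qed

text \<open>The part of the event on which the state is \<open>Yellow\<close> already has positive
  probability.\<close>

lemma prob_obs_pos:
  assumes "finite J" "J \<subseteq> {1..}"
  shows "\<P>(\<omega> in M. \<forall>j\<in>J. obs j \<omega> = s j) > 0"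
proof -
  have "0 < 1 / 2 * (\<Prod>j\<in>J. likelihood j (s j) Yellow)"
    using assms by (auto intro!: prod_pos likelihood_pos)
  also have "\<dots> = \<P>(\<omega> in M. theta \<omega> = Yellow \<and> (\<forall>j\<in>J. obs j \<omega> = s j))"
    by (rule prob_theta_obs[OF assms, symmetric])
  also have "\<dots> \<le> \<P>(\<omega> in M. \<forall>j\<in>J. obs j \<omega> = s j)"
    using obs_event[OF assms] by (intro finite_measure_mono) auto
  finally show ?thesis .
qed

text \<open>Makes the update rule applicable to every new draw, of either colour.\<close>

lemma cond_prob_draw_pos:
  assumes "set js \<subseteq> {1..}" "1 \<le> j" "j \<notin> set js"
  shows "\<P>(\<omega> in M. occurs (Draw j c) \<omega> \<bar> occurs_all (map (\<lambda>j. Draw j (s j)) js) \<omega>) > 0"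
proof -
  have "{\<omega> \<in> space M. obs j \<omega> = c \<and> (\<forall>i\<in>set js. obs i \<omega> = s i)}
    = {\<omega> \<in> space M. \<forall>i\<in>insert j (set js). obs i \<omega> = (s(j := c)) i}"
    using assms by auto
  then have "\<P>(\<omega> in M. obs j \<omega> = c \<and> (\<forall>i\<in>set js. obs i \<omega> = s i)) > 0"
    using prob_obs_pos[of "insert j (set js)" "s(j := c)"] assms by simp
  then show ?thesis
    using prob_obs_pos[of "set js" s] assms by (simp add: cond_prob_def occurs_all_draws)
qed

text \<open>Updates telescope, and each increment is independent of the draws before it.
  \<open>L\<close> is any function that satisfies the update rule;
  \<open>quasi_bayesian_logit\<close> supplies it.\<close>

lemma belief_after_draws:
  assumes update: "\<And>h e. history h \<Longrightarrow> history (h @ [e]) \<Longrightarrow>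
      \<P>(\<omega> in M. occurs e \<omega> \<bar> occurs_all h \<omega>) > 0 \<Longrightarrow> L (h @ [e]) = L h + K_info h e"
    and "sorted_wrt (<) js" "set js \<subseteq> {1..}"
  shows "L (map (\<lambda>j. Draw j (s j)) js) = L [] + (\<Sum>j\<in>set js. K_draw j (s j))"
  using assms(2,3)
proof (induction js rule: rev_induct)
  case Nil
  then show ?case by simp
next
  case (snoc j js)
  let ?h = "map (\<lambda>j. Draw j (s j)) js"
  have js: "sorted_wrt (<) js" "set js \<subseteq> {1..}" "1 \<le> j" "j \<notin> set js"
    using snoc.prems by (auto simp: sorted_wrt_append)
  have "L (?h @ [Draw j (s j)]) = L ?h + K_info ?h (Draw j (s j))"
    using history_draws_sorted[OF js(1,2), of s] history_draws_sorted[OF snoc.prems, of s]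
    by (intro update cond_prob_draw_pos js) simp_all
  then show ?case
    using snoc.IH[OF js(1,2)] js K_info_draw[OF js(2-4), of s "s j"] by (simp add: add_ac)
qed

section \<open>Verification and retraction\<close>

text \<open>\<open>verifying\<close> speaks of the whole indicator vector, a retraction of one entry
  only. Splitting by the vector links the two; \<open>Q\<close> will be an event about selection,
  state and draws.\<close>

lemma prob_split_indicators:
  assumes Q: "{\<omega> \<in> space M. Q \<omega>} \<in> events" and r: "r \<in> {1..t}"
  shows "\<P>(\<omega> in M. Q \<omega> \<and> ind r \<omega> = Noise)
    = (\<Sum>n | n \<in> {1..t} \<rightarrow>\<^sub>E UNIV \<and> n r = Noise. \<P>(\<omega> in M. Q \<omega> \<and> (\<forall>j\<in>{1..t}. ind j \<omega> = n j)))"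
proof -
  let ?F = "{n :: nat \<Rightarrow> indicator. n \<in> {1..t} \<rightarrow>\<^sub>E UNIV \<and> n r = Noise}"
  let ?E = "\<lambda>n. {\<omega> \<in> space M. Q \<omega> \<and> (\<forall>j\<in>{1..t}. ind j \<omega> = n j)}"
  have fin: "finite ?F"
    by (rule finite_subset[OF _ finite_PiE[of "{1..t}" "\<lambda>_. UNIV"]]) auto
  have "{\<omega> \<in> space M. Q \<omega> \<and> ind r \<omega> = Noise} = (\<Union>n\<in>?F. ?E n)"
  proof (intro set_eqI iffI)
    fix \<omega> assume "\<omega> \<in> {\<omega> \<in> space M. Q \<omega> \<and> ind r \<omega> = Noise}"
    then show "\<omega> \<in> (\<Union>n\<in>?F. ?E n)"
      \<comment> \<open>The witness is the realised indicator vector, made extensional by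
        \<open>restrict\<close>.\<close>
      using r by (intro UN_I[of "restrict (\<lambda>j. ind j \<omega>) {1..t}"]) auto
  next
    fix \<omega> assume "\<omega> \<in> (\<Union>n\<in>?F. ?E n)"
    then show "\<omega> \<in> {\<omega> \<in> space M. Q \<omega> \<and> ind r \<omega> = Noise}"
      using r by auto
  qed
  moreover have "prob (\<Union>n\<in>?F. ?E n) = (\<Sum>n\<in>?F. prob (?E n))"
  proof (rule finite_measure_finite_Union[OF fin])
    have "?E n \<in> events" for n
    proof -
      have "Measurable.pred M (\<lambda>\<omega>. ind j \<omega> = n j)" if "j \<in> {1..t}" for j
      proof -
        have [measurable]: "ind j \<in> M \<rightarrow>\<^sub>M count_space UNIV"
          using that by (intro ind_measurable) auto
        show ?thesis by measurable
      qed
      then have "Measurable.pred M (\<lambda>\<omega>. Q \<omega> \<and> (\<forall>j\<in>{1..t}. ind j \<omega> = n j))"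
        using Q by (intro pred_intros_logic pred_intros_finite) (auto simp: pred_def)
      then show ?thesis by (rule predE)
    qed
    then show "?E ` ?F \<subseteq> events" by blast
    show "disjoint_family_on ?E ?F"
      unfolding disjoint_family_on_def
    proof (intro ballI impI)
      fix m n assume mn: "m \<in> ?F" "n \<in> ?F" "m \<noteq> n"
      \<comment> \<open>Extensional functions agree outside \<open>{1..t}\<close>, so distinct ones
        differ at an index that the event tests.\<close>
      have "\<exists>j\<in>{1..t}. m j \<noteq> n j"
      proof (rule ccontr)
        assume "\<not> ?thesis"
        then have "m = n" using mn by (intro PiE_ext[of m "{1..t}" "\<lambda>_. UNIV" n]) auto
        with mn show False by simp
      qed
      then show "?E m \<inter> ?E n = {}" by auto
    qed
  qed
  ultimately show ?thesis by simp
qed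

text \<open>Summing the independence condition over all indicator vectors with noise at
  \<open>r\<close> shows that, given the draws, selection of \<open>r\<close> is independent of the
  state together with \<open>r\<close> being noise.\<close>

lemma verifying_noise:
  fixes s :: "nat \<Rightarrow> color"
  assumes "verifying" and t: "1 \<le> t" and r: "r \<in> {1..t}"
  defines "D \<equiv> \<lambda>\<omega>. \<forall>j\<in>{1..t}. obs j \<omega> = s j"
  shows "\<P>(\<omega> in M. (selected (t + 1) \<omega> = r \<and> ind r \<omega> = Noise) \<and> D \<omega> \<and> theta \<omega> = x)
    = \<P>(\<omega> in M. selected (t + 1) \<omega> = r \<bar> D \<omega>) * \<P>(\<omega> in M. theta \<omega> = x \<and> ind r \<omega> = Noise \<and> D \<omega>)"
proof -
  let ?F = "{n :: nat \<Rightarrow> indicator. n \<in> {1..t} \<rightarrow>\<^sub>E UNIV \<and> n r = Noise}"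
  note [measurable] = selected_measurable[OF t]
  have [measurable]: "Measurable.pred M D"
    unfolding D_def using obs_event[of "{1..t}" s] by (auto simp: pred_def)
  have D_pos: "prob {\<omega> \<in> space M. D \<omega>} > 0"
    unfolding D_def by (rule prob_obs_pos) auto
  have occ: "occurs_all (draws s t) \<omega> \<longleftrightarrow> D \<omega>" for \<omega>
    by (simp add: draws_def occurs_all_draws D_def atLeastLessThanSuc_atLeastAtMost del: upt_Suc)
  \<comment> \<open>For one vector \<open>n\<close> this is \<open>verifying\<close> with
    conditional probabilities multiplied out by the positive probability of
    \<open>D\<close>.\<close>
  have factor: "\<P>(\<omega> in M. (selected (t + 1) \<omega> = r \<and> theta \<omega> = x \<and> D \<omega>) \<and> (\<forall>j\<in>{1..t}. ind j \<omega> = n j))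
    = \<P>(\<omega> in M. selected (t + 1) \<omega> = r \<bar> D \<omega>)
      * \<P>(\<omega> in M. (theta \<omega> = x \<and> D \<omega>) \<and> (\<forall>j\<in>{1..t}. ind j \<omega> = n j))" for n
  proof -
    let ?I = "\<lambda>\<omega>. \<forall>j\<in>{1..t}. ind j \<omega> = n j"
    have "\<P>(\<omega> in M. selected (t + 1) \<omega> = r \<and> (theta \<omega> = x \<and> ?I \<omega>) \<bar> D \<omega>)
      = \<P>(\<omega> in M. selected (t + 1) \<omega> = r \<bar> D \<omega>) * \<P>(\<omega> in M. theta \<omega> = x \<and> ?I \<omega> \<bar> D \<omega>)"
      using assms(1)[unfolded verifying_def, rule_format, OF t, of r x n s] unfolding occ .
    then have "\<P>(\<omega> in M. (selected (t + 1) \<omega> = r \<and> (theta \<omega> = x \<and> ?I \<omega>)) \<and> D \<omega>)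
      = \<P>(\<omega> in M. selected (t + 1) \<omega> = r \<bar> D \<omega>) * \<P>(\<omega> in M. (theta \<omega> = x \<and> ?I \<omega>) \<and> D \<omega>)"
      unfolding cond_prob_def[of M "\<lambda>\<omega>. selected (t + 1) \<omega> = r \<and> (theta \<omega> = x \<and> ?I \<omega>)"]
        cond_prob_def[of M "\<lambda>\<omega>. theta \<omega> = x \<and> ?I \<omega>"]
      using D_pos by (simp add: field_simps)
    then show ?thesis by (simp only: conj_ac)
  qed
  have "\<P>(\<omega> in M. (selected (t + 1) \<omega> = r \<and> ind r \<omega> = Noise) \<and> D \<omega> \<and> theta \<omega> = x)
    = \<P>(\<omega> in M. (selected (t + 1) \<omega> = r \<and> theta \<omega> = x \<and> D \<omega>) \<and> ind r \<omega> = Noise)"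
    by (simp only: conj_ac)
  also have "\<dots> = (\<Sum>n\<in>?F. \<P>(\<omega> in M. (selected (t + 1) \<omega> = r \<and> theta \<omega> = x \<and> D \<omega>)
      \<and> (\<forall>j\<in>{1..t}. ind j \<omega> = n j)))"
    by (rule prob_split_indicators[OF _ r]) measurable
  \<comment> \<open>The selection factor does not depend on \<open>n\<close> and leaves the
    sum.\<close>
  also have "\<dots> = \<P>(\<omega> in M. selected (t + 1) \<omega> = r \<bar> D \<omega>)
      * (\<Sum>n\<in>?F. \<P>(\<omega> in M. (theta \<omega> = x \<and> D \<omega>) \<and> (\<forall>j\<in>{1..t}. ind j \<omega> = n j)))"
    unfolding factor sum_distrib_left ..
  also have "(\<Sum>n\<in>?F. \<P>(\<omega> in M. (theta \<omega> = x \<and> D \<omega>) \<and> (\<forall>j\<in>{1..t}. ind j \<omega> = n j)))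
    = \<P>(\<omega> in M. (theta \<omega> = x \<and> D \<omega>) \<and> ind r \<omega> = Noise)"
    by (rule prob_split_indicators[OF _ r, symmetric]) measurable
  finally show ?thesis by (simp only: conj_ac)
qed

text \<open>
  Once observation \<open>r\<close> is known to be noise, its colour carries no information on the state, so
  the retraction leaves the likelihood of the other draws and cancels that of draw \<open>r\<close>.
\<close>

lemma K_info_retraction:
  assumes "verifying" and t: "1 \<le> t" and r: "r \<in> {1..t}"
    and pos: "\<P>(\<omega> in M. occurs (Retraction (t + 1) r) \<omega> \<bar> occurs_all (draws s t) \<omega>) > 0"
  shows "K_info (draws s t) (Retraction (t + 1) r) = - K_draw r (s r)"
proof -
  define D where "D \<omega> \<longleftrightarrow> (\<forall>j\<in>{1..t}. obs j \<omega> = s j)" for \<omega>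
  \<comment> \<open>The weights \<open>q\<close> and \<open>w\<close> are the same in both states
    and will cancel in the likelihood ratio.\<close>
  define q where "q = \<P>(\<omega> in M. selected (t + 1) \<omega> = r \<bar> D \<omega>)"
  define w where "w = pair_prob r {(Noise, s r)}"
  note [measurable] = selected_measurable[OF t]
  have [measurable]: "Measurable.pred M D"
    unfolding D_def using obs_event[of "{1..t}" s] by (auto simp: pred_def)
  have r1: "1 \<le> r" using r by simp
  have occ: "occurs_all (draws s t) \<omega> \<longleftrightarrow> D \<omega>" for \<omega>
    by (simp add: draws_def occurs_all_draws D_def atLeastLessThanSuc_atLeastAtMost del: upt_Suc)
  have "w > 0" unfolding w_def by (rule pair_prob_noise_pos[OF r1])
  \<comment> \<open>A retraction of \<open>r\<close> requires that \<open>r\<close> be selected, so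
    positivity of its conditional probability passes to \<open>q\<close>.\<close>
  have "\<P>(\<omega> in M. (selected (t + 1) \<omega> = r \<and> ind r \<omega> = Noise) \<and> D \<omega>)
      \<le> \<P>(\<omega> in M. selected (t + 1) \<omega> = r \<and> D \<omega>)"
    by (rule finite_measure_mono) (blast, measurable)
  then have "\<P>(\<omega> in M. occurs (Retraction (t + 1) r) \<omega> \<bar> occurs_all (draws s t) \<omega>) \<le> q"
    unfolding occ q_def cond_prob_def by (simp add: divide_right_mono)
  with pos have "q > 0" by linarith
  have cond: "\<P>(\<omega> in M. occurs (Retraction (t + 1) r) \<omega> \<bar> D \<omega> \<and> theta \<omega> = x)
      = q * w / likelihood r (s r) x" for x
  proof -
    \<comment> \<open>The draws other than \<open>r\<close> contribute \<open>R\<close> to numerator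
      and denominator alike; at \<open>r\<close> the state-independent \<open>w\<close> meets the
      likelihood of \<open>s r\<close>.\<close>
    define R where "R = (\<Prod>j\<in>{1..t} - {r}. likelihood j (s j) x)"
    have "R > 0" unfolding R_def by (auto intro!: prod_pos likelihood_pos)
    have "\<P>(\<omega> in M. D \<omega> \<and> theta \<omega> = x) = 1 / 2 * (\<Prod>j\<in>{1..t}. likelihood j (s j) x)"
      using prob_theta_obs[of "{1..t}" x s] unfolding D_def by (simp add: conj_commute)
    also have "(\<Prod>j\<in>{1..t}. likelihood j (s j) x) = likelihood r (s r) x * R"
      unfolding R_def using r by (intro prod.remove) auto
    finally have "\<P>(\<omega> in M. D \<omega> \<and> theta \<omega> = x) = 1 / 2 * (likelihood r (s r) x * R)" .
    moreover have "\<P>(\<omega> in M. (selected (t + 1) \<omega> = r \<and> ind r \<omega> = Noise) \<and> D \<omega> \<and> theta \<omega> = x)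
        = q * (1 / 2 * (w * R))"
      using verifying_noise[OF assms(1) t r, of s x] prob_theta_obs_noise[of "{1..t}" r x s] r
      unfolding q_def w_def R_def D_def by simp
    ultimately show ?thesis
      using \<open>R > 0\<close> by (simp only: cond_prob_def occurs.simps) simp
  qed
  have lp: "likelihood r (s r) x > 0" for x by (rule likelihood_pos[OF r1])
  have "K_info (draws s t) (Retraction (t + 1) r)
    = ln ((q * w / likelihood r (s r) Yellow) / (q * w / likelihood r (s r) Blue))"
    unfolding K_info_def occ cond ..
  also have "\<dots> = ln (likelihood r (s r) Blue / likelihood r (s r) Yellow)"
    using \<open>q > 0\<close> \<open>w > 0\<close> by simp
  also have "\<dots> = - K_draw r (s r)"
    using lp[of Yellow] lp[of Blue] by (simp add: K_draw_likelihood[OF r1] ln_div)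
  finally show ?thesis .
qed

section \<open>Comparison of beliefs on the log-odds scale\<close>

text \<open>\<open>L\<close> is the log-odds of the inverse of \<open>f\<close> at the belief. At
  histories of positive probability beliefs lie in the range of \<open>f\<close>, where this
  transformation is injective, so comparing \<open>L\<close> compares beliefs.\<close>

lemma quasi_bayesian_logit:
  assumes "quasi_bayesian B"
  obtains L :: "info list \<Rightarrow> real"
  where "\<And>h e. history h \<Longrightarrow> history (h @ [e]) \<Longrightarrow>
      \<P>(\<omega> in M. occurs e \<omega> \<bar> occurs_all h \<omega>) > 0 \<Longrightarrow> L (h @ [e]) = L h + K_info h e"
    and "\<And>h h'. history h \<Longrightarrow> \<P>(\<omega> in M. occurs_all h \<omega>) > 0 \<Longrightarrow>
      history h' \<Longrightarrow> \<P>(\<omega> in M. occurs_all h' \<omega>) > 0 \<Longrightarrow> B h = B h' \<longleftrightarrow> L h = L h'"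
proof -
  obtain f :: "real \<Rightarrow> real" where mono: "strict_mono_on {0<..<1} f"
    and range: "\<And>h. history h \<Longrightarrow> \<P>(\<omega> in M. occurs_all h \<omega>) > 0 \<Longrightarrow> B h \<in> f ` {0<..<1}"
    and update: "\<And>h e. history h \<Longrightarrow> history (h @ [e]) \<Longrightarrow>
      \<P>(\<omega> in M. occurs e \<omega> \<bar> occurs_all h \<omega>) > 0 \<Longrightarrow>
        logit (the_inv_into {0<..<1} f (B (h @ [e])))
          = logit (the_inv_into {0<..<1} f (B h)) + K_info h e"
    using assms unfolding quasi_bayesian_def by blast
  have inj: "inj_on f {0<..<1}" using mono by (rule strict_mono_on_imp_inj_on)
  show thesis
  proof (rule that[of "\<lambda>h. logit (the_inv_into {0<..<1} f (B h))"])
    fix h h'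
    assume h: "history h" "\<P>(\<omega> in M. occurs_all h \<omega>) > 0"
      and h': "history h'" "\<P>(\<omega> in M. occurs_all h' \<omega>) > 0"
    obtain p p' where "p \<in> {0<..<1}" "B h = f p" "p' \<in> {0<..<1}" "B h' = f p'"
      using range[OF h] range[OF h'] by (elim imageE)
    then show "B h = B h' \<longleftrightarrow>
        logit (the_inv_into {0<..<1} f (B h)) = logit (the_inv_into {0<..<1} f (B h'))"
      using inj logit_inj_on by (simp add: the_inv_into_f_f inj_on_eq_iff)
  qed (fact update)
qed

text \<open>The numerator of the conditional probability is the probability of the extended
  history.\<close>

lemma prob_append_pos:
  assumes "\<P>(\<omega> in M. occurs e \<omega> \<bar> occurs_all h \<omega>) > 0"
  shows "\<P>(\<omega> in M. occurs_all (h @ [e]) \<omega>) > 0"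
proof -
  have "{\<omega> \<in> space M. occurs_all (h @ [e]) \<omega>} = {\<omega> \<in> space M. occurs e \<omega> \<and> occurs_all h \<omega>}"
    by (auto simp: occurs_all_def)
  then show ?thesis
    using assms by (simp add: cond_prob_def zero_less_divide_iff zero_less_measure_iff)
qed

lemma retraction_beliefs:
  assumes "verifying" and "quasi_bayesian B" and t: "1 \<le> t" and r: "r \<in> {1..t}"
    and pos: "\<P>(\<omega> in M. occurs (Retraction (t + 1) r) \<omega> \<bar> occurs_all (draws s t) \<omega>) > 0"
  shows "B (draws s t @ [Retraction (t + 1) r]) = B (draws_omitting s t r)"
    and "B (draws s t @ [Retraction (t + 1) r]) = B (draws s t @ [Draw (t + 1) c])
      \<longleftrightarrow> K_draw (t + 1) c = - K_draw r (s r)"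
proof -
  obtain L :: "info list \<Rightarrow> real"
    where update: "\<And>h e. history h \<Longrightarrow> history (h @ [e]) \<Longrightarrow>
        \<P>(\<omega> in M. occurs e \<omega> \<bar> occurs_all h \<omega>) > 0 \<Longrightarrow> L (h @ [e]) = L h + K_info h e"
      and L_eq: "\<And>h h'. history h \<Longrightarrow> \<P>(\<omega> in M. occurs_all h \<omega>) > 0 \<Longrightarrow>
        history h' \<Longrightarrow> \<P>(\<omega> in M. occurs_all h' \<omega>) > 0 \<Longrightarrow> B h = B h' \<longleftrightarrow> L h = L h'"
    using quasi_bayesian_logit[OF assms(2)] by blast
  let ?js = "[1..<Suc t]" and ?ks = "filter (\<lambda>j. j \<noteq> r) [1..<Suc t]"
  have js: "sorted_wrt (<) ?js" "set ?js \<subseteq> {1..}" by (auto simp del: upt_Suc)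
  have ks: "sorted_wrt (<) ?ks" "set ?ks \<subseteq> {1..}"
    by (auto intro: sorted_wrt_filter simp del: upt_Suc)
  have new: "1 \<le> t + 1" "t + 1 \<notin> set ?js" by auto
  have hist: "history (draws s t)" "history (draws_omitting s t r)"
    unfolding draws_def draws_omitting_def by (rule history_draws_sorted js ks)+
  have hist_ret: "history (draws s t @ [Retraction (t + 1) r])"
    using r by (rule history.retraction)
  have hist_new: "history (draws s t @ [Draw (t + 1) c])"
    using hist(1) by (rule history.draw) (auto simp: draws_def)
  have pos_new: "\<P>(\<omega> in M. occurs (Draw (t + 1) c) \<omega> \<bar> occurs_all (draws s t) \<omega>) > 0"
    unfolding draws_def by (rule cond_prob_draw_pos[OF js(2) new])
  \<comment> \<open>For \<open>t = 1\<close> the list is empty and the event is the whole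
    space.\<close>
  have pos_omit: "\<P>(\<omega> in M. occurs_all (draws_omitting s t r) \<omega>) > 0"
    unfolding draws_omitting_def occurs_all_draws by (rule prob_obs_pos) (use ks in auto)
  have L_ret: "L (draws s t @ [Retraction (t + 1) r]) = L (draws s t) - K_draw r (s r)"
    using update[OF hist(1) hist_ret pos] K_info_retraction[OF assms(1) t r pos] by simp
  have L_new: "L (draws s t @ [Draw (t + 1) c]) = L (draws s t) + K_draw (t + 1) c"
    using update[OF hist(1) hist_new pos_new] K_info_draw[OF js(2) new, of s c]
    by (simp add: draws_def)
  have "L (draws s t) = L [] + (\<Sum>j\<in>set ?js. K_draw j (s j))"
    unfolding draws_def by (rule belief_after_draws[OF update js])
  \<comment> \<open>Isolates the summand of \<open>r\<close>, which the retraction removes; what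
    remains is the sum for the history without draw \<open>r\<close>.\<close>
  also have "(\<Sum>j\<in>set ?js. K_draw j (s j)) = K_draw r (s r) + (\<Sum>j\<in>set ?js - {r}. K_draw j (s j))"
    using r by (intro sum.remove) auto
  also have "set ?js - {r} = set ?ks" by auto
  also have "L [] + (K_draw r (s r) + (\<Sum>j\<in>set ?ks. K_draw j (s j)))
      = L (draws_omitting s t r) + K_draw r (s r)"
    using belief_after_draws[OF update ks, of s] by (simp add: draws_omitting_def)
  finally have "L (draws s t) = L (draws_omitting s t r) + K_draw r (s r)" .
  then show "B (draws s t @ [Retraction (t + 1) r]) = B (draws_omitting s t r)"
    using L_eq[OF hist_ret prob_append_pos[OF pos] hist(2) pos_omit] L_ret by simp
  \<comment> \<open>Both histories extend \<open>draws s t\<close>, so only the last increments are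
    compared.\<close>
  show "B (draws s t @ [Retraction (t + 1) r]) = B (draws s t @ [Draw (t + 1) c])
      \<longleftrightarrow> K_draw (t + 1) c = - K_draw r (s r)"
    using L_eq[OF hist_ret prob_append_pos[OF pos] hist_new prob_append_pos[OF pos_new]] L_ret L_new
    by auto
qed

end

theorem proposition1:
  fixes M :: "'a measure"
    and theta :: "'a \<Rightarrow> color"
    and ind :: "nat \<Rightarrow> 'a \<Rightarrow> indicator"
    and eps :: "nat \<Rightarrow> 'a \<Rightarrow> color"
    and selected :: "nat \<Rightarrow> 'a \<Rightarrow> nat"
    and B :: "info list \<Rightarrow> real"
    and s :: "nat \<Rightarrow> color"
    and t \<rho> :: nat
  assumes "retraction_model M theta ind eps selected"
    and "retraction_model.verifying M theta ind eps selected"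
    and "retraction_model.quasi_bayesian M theta ind eps selected B"
    and "t \<ge> 1" and "\<rho> \<in> {1..t}"
    and "\<P>(\<omega> in M. retraction_model.occurs theta ind eps selected (Retraction (t + 1) \<rho>) \<omega>
           \<bar> retraction_model.occurs_all theta ind eps selected (draws s t) \<omega>) > 0"
  shows "B (draws s t @ [Retraction (t + 1) \<rho>]) = B (draws_omitting s t \<rho>) \<and>
    (\<forall>c. B (draws s t @ [Retraction (t + 1) \<rho>]) = B (draws s t @ [Draw (t + 1) c]) \<longleftrightarrow>
       retraction_model.K_draw M theta ind eps (t + 1) c
         = - retraction_model.K_draw M theta ind eps \<rho> (s \<rho>))"
  by (intro conjI allI retraction_model.retraction_beliefs[OF assms])

end
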